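(* Let $R$ be a commutative associative unital ring with $3R=0$. Then the matrix of any $R$-algebra automorphism of $W(2)_R$ relative to the basis $e_1,\dots,e_8$ is of the form $$M_{a,b,c,k}=\begin{pmatrix} 1&0&c&0&0&0&0&0\\ -\frac{c}{a}&\frac1a&\frac{c^2}{a}&-\frac{c^3}{a}&0&0&0&0\\ 0&0&a&0&0&0&0&0\\ 0&0&0&a^2&0&0&0&0\\ b-1&0&bc-c&0&b&bc&0&0\\ 0&0&ab-a&0&0&ab&0&0\\ 0&0&ak&0&0&ak&a&0\\ -k&0&-ck&0&-k&-ck&-c&1 \end{pmatrix}$$ with $a,b\in R^\times$ and $c,k\in R$.
   Context: $W(2)_R=\bigoplus_{i=1}^8Re_i$ is the (non-associative) $R$-algebra, free as an $R$-module with basis $e_1,\dots,e_8$, with $R$-bilinear product given by (zero products omitted): $e_1e_1=-e_1$, $e_1e_2=-3e_2$, $e_1e_3=e_3$, $e_1e_4=3e_4$, $e_1e_5=-e_5$, $e_1e_6=e_6$, $e_1e_7=e_7$, $e_1e_8=-e_8$; $e_2e_1=3e_2$, $e_2e_3=2e_1$, $e_2e_4=e_3$, $e_2e_6=-e_5$, $e_2e_7=e_8$; $e_3e_1=-2e_3$, $e_3e_2=-e_1$, $e_3e_3=-3e_4$, $e_3e_5=e_6$, $e_3e_8=-e_7$; $e_5e_1=-2e_1$, $e_5e_2=-3e_2$, $e_5e_3=-e_3$, $e_5e_5=-2e_5$, $e_5e_6=-e_6$, $e_5e_7=-e_7$, $e_5e_8=-2e_8$; $e_6e_1=2e_3$,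 $e_6e_2=e_1$, $e_6e_3=3e_4$, $e_6e_5=-e_6$, $e_6e_8=e_7$; $e_7e_1=2e_3$, $e_7e_2=e_1$, $e_7e_3=3e_4$, $e_7e_5=-e_6$, $e_7e_8=e_7$; $e_8e_2=e_2$, $e_8e_3=-e_3$, $e_8e_4=-2e_4$, $e_8e_6=-e_6$, $e_8e_7=-e_7$. Matrix convention: the $i$-th row of the matrix of a linear map $\theta$ consists of the coordinates of $\theta(e_i)$ in the basis. $R^\times$ is the group of units of $R$. *)

theory Defs
  imports "HOL-Analysis.Analysis"
begin

text \<open>
  Commutative associative unital rings. Unlike \<open>comm_ring_1\<close>, this class does not demand
  \<open>0 \<noteq> 1\<close>, so the zero ring is included. The last two classes only provide numerals; they
  add no axioms to the first two.
\<close>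

class comm_unital_ring = comm_ring + comm_monoid_mult + neg_numeral + semiring_numeral

instance comm_ring_1 \<subseteq> comm_unital_ring ..

text \<open>Only meaningful for \<open>a dvd 1\<close>, and then unique.\<close>

definition unit_inv :: "'a::comm_unital_ring \<Rightarrow> 'a" where
  "unit_inv a = (THE u. a * u = 1)"

text \<open>
  The free module of rank 8 is \<open>'a ^ 8\<close>. The elements of the index type \<open>8\<close> are
  \<open>1, \<dots>, 7\<close> and \<open>8 = 0\<close>, and \<open>vector [x1, \<dots>, x8]\<close> has \<open>i\<close>-th component \<open>xi\<close>.
\<close>

definition W2_basis :: "8 \<Rightarrow> 'a::comm_unital_ring ^ 8" where
  "W2_basis i = axis i 1"

text \<open>The entry in row \<open>i\<close> and column \<open>j\<close> is the product \<open>e i e j\<close> in \<open>W(2)\<close>.\<close>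

definition W2_table :: "'a::comm_unital_ring ^ 8 ^ 8 ^ 8" where
  "W2_table = (let e = W2_basis in vector [
     vector [(-1) *s e 1, (-3) *s e 2,        e 3,    3 *s e 4, (-1) *s e 5,        e 6,        e 7, (-1) *s e 8],
     vector [   3 *s e 2,           0,   2 *s e 1,         e 3,           0, (-1) *s e 5,       e 8,           0],
     vector [(-2) *s e 3, (-1) *s e 1, (-3) *s e 4,          0,         e 6,           0,         0, (-1) *s e 7],
     vector [          0,           0,          0,           0,           0,           0,         0,           0],
     vector [(-2) *s e 1, (-3) *s e 2, (-1) *s e 3,          0, (-2) *s e 5, (-1) *s e 6, (-1) *s e 7, (-2) *s e 8],
     vector [   2 *s e 3,         e 1,   3 *s e 4,           0, (-1) *s e 6,           0,         0,         e 7],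
     vector [   2 *s e 3,         e 1,   3 *s e 4,           0, (-1) *s e 6,           0,         0,         e 7],
     vector [          0,         e 2, (-1) *s e 3, (-2) *s e 4,          0, (-1) *s e 6, (-1) *s e 7,         0]])"

definition W2_mult :: "'a::comm_unital_ring ^ 8 \<Rightarrow> 'a ^ 8 \<Rightarrow> 'a ^ 8" where
  "W2_mult x y = (\<Sum>i\<in>UNIV. \<Sum>j\<in>UNIV. (x $ i * y $ j) *s (W2_table $ i $ j))"

definition W2_automorphism :: "('a::comm_unital_ring ^ 8 \<Rightarrow> 'a ^ 8) \<Rightarrow> bool" where
  "W2_automorphism \<theta> \<longleftrightarrow>
     bij \<theta> \<and>
     (\<forall>x y. \<theta> (x + y) = \<theta> x + \<theta> y) \<and>
     (\<forall>r x. \<theta> (r *s x) = r *s \<theta> x) \<and>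
     (\<forall>x y. \<theta> (W2_mult x y) = W2_mult (\<theta> x) (\<theta> y))"

text \<open>
  The library's \<open>matrix\<close> puts the coordinates of the image of the \<open>j\<close>-th basis vector into column \<open>j\<close>.
  Here they form a row.
\<close>

definition row_matrix :: "('a::comm_unital_ring ^ 8 \<Rightarrow> 'a ^ 8) \<Rightarrow> 'a ^ 8 ^ 8" where
  "row_matrix \<theta> = transpose (matrix \<theta>)"

definition W2_aut_matrix :: "'a::comm_unital_ring \<Rightarrow> 'a \<Rightarrow> 'a \<Rightarrow> 'a \<Rightarrow> 'a ^ 8 ^ 8" where
  "W2_aut_matrix a b c k = (let a' = unit_inv a in vector [
     vector [      1,  0,         c,            0,   0,         0,   0, 0],
     vector [-c * a', a', c^2 * a', - (c^3) * a',    0,         0,   0, 0],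
     vector [      0,  0,         a,            0,   0,         0,   0, 0],
     vector [      0,  0,         0,          a^2,   0,         0,   0, 0],
     vector [  b - 1,  0, b * c - c,            0,   b,     b * c,   0, 0],
     vector [      0,  0, a * b - a,            0,   0,     a * b,   0, 0],
     vector [      0,  0,     a * k,            0,   0,     a * k,   a, 0],
     vector [     -k,  0,  -(c * k),            0,  -k,  -(c * k),  -c, 1]])"

end

theory Submission
  imports Defs
begin

text \<open>
  Write \<open>e\<^sub>1, \<dots>, e\<^sub>8\<close> for the given basis of \<open>W(2)\<close>. When \<open>3 = 0\<close>, the elements \<open>e\<^sub>1 + e\<^sub>5\<close> and \<open>e\<^sub>3 + e\<^sub>6\<close>
  annihilate the algebra from the left, and so does \<open>e\<^sub>4\<close>. Putting the first two in place of \<open>e\<^sub>5\<close> and \<open>e\<^sub>6\<close> gives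
  an adapted basis \<open>f\<^sub>1, \<dots>, f\<^sub>8\<close>, in which left multiplication by \<open>x\<close> depends only on the four scalars
  \<open>x\<^sub>1\<close>, \<open>x\<^sub>2\<close>, \<open>x\<^sub>3 - x\<^sub>7\<close> and \<open>x\<^sub>8\<close> (\<open>adapted_W2_mult\<close>). The proof takes place in this basis.

  The ring may have zero divisors and nilpotents, so every step has to be an identity or the inversion of a
  unit. Invariants provide a start. An automorphism \<open>\<psi>\<close> conjugates left multiplication by \<open>x\<close> to left
  multiplication by \<open>\<psi> x\<close>, hence preserves its trace, which is \<open>- x\<^sub>8\<close> (\<open>trace_adapted_mult\<close>). Applied to a
  product \<open>x y\<close>, this shows that \<open>\<psi>\<close> preserves the bilinear form \<open>- x\<^sub>1 y\<^sub>8 + x\<^sub>2 y\<^sub>7\<close> (\<open>form_invariant\<close>).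
  The form determines coordinates 1, 2 and 7 of \<open>\<psi> x\<close> up to a unit \<open>a\<close> and a scalar \<open>c\<close>
  (\<open>coordinates_1_2_7\<close>). Moreover \<open>\<psi>\<close> preserves the left annihilator, on which \<open>x\<^sub>3 = x\<^sub>7\<close>; this
  gives coordinate 3 for elements of the annihilator (\<open>left_annihilator\<close>).

  The remaining coordinates come from the multiplication table (\<open>images_of_adapted_basis\<close>). Left multiplication
  by \<open>f\<^sub>8\<close> has the eigenvalues \<open>0\<close>, \<open>1\<close> and \<open>-1\<close> on the adapted basis, and each of \<open>f\<^sub>2, f\<^sub>4, f\<^sub>6, f\<^sub>7\<close> is an
  eigenvector for \<open>1\<close> or \<open>-1\<close>. Applying \<open>\<psi>\<close> to these four relations determines all but a few coordinates of
  their images. The products \<open>f\<^sub>2 f\<^sub>4 = f\<^sub>3\<close>, \<open>f\<^sub>2 f\<^sub>3 = - f\<^sub>1\<close>, \<open>f\<^sub>2 f\<^sub>6 = - f\<^sub>5\<close> and \<open>f\<^sub>2 f\<^sub>7 = f\<^sub>8\<close> give the images of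
  the other basis elements, and \<open>f\<^sub>2 f\<^sub>2 = 0\<close> gives the last unknown coordinate, the fourth one of \<open>\<psi> f\<^sub>2\<close>.
\<close>

section \<open>Vectors with eight components\<close>

lemma exhaust_8: "x = 1 \<or> x = 2 \<or> x = 3 \<or> x = 4 \<or> x = 5 \<or> x = 6 \<or> x = 7 \<or> x = 8" for x :: 8
proof (induct x)
  case (of_int z)
  then have "z = 0 \<or> z = 1 \<or> z = 2 \<or> z = 3 \<or> z = 4 \<or> z = 5 \<or> z = 6 \<or> z = 7" by fastforce
  then show ?case by auto
qed

lemma forall_8:
  "(\<forall>i::8. P i) \<longleftrightarrow> P 1 \<and> P 2 \<and> P 3 \<and> P 4 \<and> P 5 \<and> P 6 \<and> P 7 \<and> P 8"
  by (metis exhaust_8)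

lemma sum_8: "sum f (UNIV::8 set) = f 1 + f 2 + f 3 + f 4 + f 5 + f 6 + f 7 + f 8"
proof -
  have UNIV_8: "(UNIV::8 set) = {1, 2, 3, 4, 5, 6, 7, 8}"
    using exhaust_8 by auto
  show ?thesis
    unfolding UNIV_8 by (simp add: add.assoc)
qed

lemma vector_8 [simp]:
  fixes x1 x2 x3 x4 x5 x6 x7 x8 :: "'b::zero"
  defines "v \<equiv> vector [x1, x2, x3, x4, x5, x6, x7, x8] :: 'b ^ 8"
  shows "v $ 1 = x1" "v $ 2 = x2" "v $ 3 = x3" "v $ 4 = x4"
    "v $ 5 = x5" "v $ 6 = x6" "v $ 7 = x7" "v $ 8 = x8"
  unfolding v_def vector_def by simp_all

section \<open>The product in the adapted basis\<close>

text \<open>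
  The coordinates of \<open>x\<close> in the basis \<open>e\<^sub>1, e\<^sub>2, e\<^sub>3, e\<^sub>4, e\<^sub>1 + e\<^sub>5, e\<^sub>3 + e\<^sub>6, e\<^sub>7, e\<^sub>8\<close>.
\<close>

definition adapted :: "'a::comm_unital_ring ^ 8 \<Rightarrow> 'a ^ 8" where
  "adapted x = vector [x $ 1 - x $ 5, x $ 2, x $ 3 - x $ 6, x $ 4, x $ 5, x $ 6, x $ 7, x $ 8]"

definition unadapted :: "'a::comm_unital_ring ^ 8 \<Rightarrow> 'a ^ 8" where
  "unadapted y = vector [y $ 1 + y $ 5, y $ 2, y $ 3 + y $ 6, y $ 4, y $ 5, y $ 6, y $ 7, y $ 8]"

lemma unadapted_adapted [simp]: "unadapted (adapted x) = x"
  by (simp add: unadapted_def adapted_def vec_eq_iff forall_8)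

lemma adapted_unadapted [simp]: "adapted (unadapted x) = x"
  by (simp add: unadapted_def adapted_def vec_eq_iff forall_8)

text \<open>
  The product of \<open>W(2)\<close> over a ring with \<open>3 = 0\<close>, in adapted coordinates. The scalar \<open>d\<close> appears because
  left multiplication by \<open>e\<^sub>7\<close> is minus left multiplication by \<open>e\<^sub>3\<close>.
\<close>

definition adapted_mult :: "'a::comm_unital_ring ^ 8 \<Rightarrow> 'a ^ 8 \<Rightarrow> 'a ^ 8" where
  "adapted_mult x y = (let d = x $ 3 - x $ 7 in vector
    [- (x $ 1 * y $ 1) - x $ 2 * y $ 3 - d * y $ 2,
     x $ 8 * y $ 2,
     x $ 1 * y $ 3 + x $ 2 * y $ 4 + d * y $ 1 - x $ 8 * y $ 3,
     x $ 8 * y $ 4,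
     - (x $ 1 * y $ 5) - x $ 2 * y $ 6,
     x $ 1 * y $ 6 + d * y $ 5 - x $ 8 * y $ 6,
     x $ 1 * y $ 7 - d * y $ 8 - x $ 8 * y $ 7,
     - (x $ 1 * y $ 8) + x $ 2 * y $ 7])"

lemma char3_numerals:
  assumes "\<forall>r::'a::comm_unital_ring. 3 * r = 0"
  shows "(3::'a) = 0" "(2::'a) = -1"
proof -
  show 3: "(3::'a) = 0"
    using assms by (metis mult_1_right)
  have "(2::'a) + 1 = 3"
    by (simp only: numeral.simps)
  then show "(2::'a) = -1"
    using 3 by (simp add: eq_neg_iff_add_eq_0)
qed

lemma W2_basis_components:
  "W2_basis 1 = vector [1,0,0,0,0,0,0,0]"
  "W2_basis 2 = vector [0,1,0,0,0,0,0,0]"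
  "W2_basis 3 = vector [0,0,1,0,0,0,0,0]"
  "W2_basis 4 = vector [0,0,0,1,0,0,0,0]"
  "W2_basis 5 = vector [0,0,0,0,1,0,0,0]"
  "W2_basis 6 = vector [0,0,0,0,0,1,0,0]"
  "W2_basis 7 = vector [0,0,0,0,0,0,1,0]"
  "W2_basis 8 = vector [0,0,0,0,0,0,0,1]"
  by (simp_all add: W2_basis_def axis_def vec_eq_iff forall_8)

lemma adapted_mult_nth [simp]:
  "adapted_mult x y $ 1 = - (x $ 1 * y $ 1) - x $ 2 * y $ 3 - (x $ 3 - x $ 7) * y $ 2"
  "adapted_mult x y $ 2 = x $ 8 * y $ 2"
  "adapted_mult x y $ 3 =
     x $ 1 * y $ 3 + x $ 2 * y $ 4 + (x $ 3 - x $ 7) * y $ 1 - x $ 8 * y $ 3"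
  "adapted_mult x y $ 4 = x $ 8 * y $ 4"
  "adapted_mult x y $ 5 = - (x $ 1 * y $ 5) - x $ 2 * y $ 6"
  "adapted_mult x y $ 6 = x $ 1 * y $ 6 + (x $ 3 - x $ 7) * y $ 5 - x $ 8 * y $ 6"
  "adapted_mult x y $ 7 = x $ 1 * y $ 7 - (x $ 3 - x $ 7) * y $ 8 - x $ 8 * y $ 7"
  "adapted_mult x y $ 8 = - (x $ 1 * y $ 8) + x $ 2 * y $ 7"
  by (simp_all add: adapted_mult_def Let_def)

lemma adapted_W2_mult:
  assumes "\<forall>r::'a::comm_unital_ring. 3 * r = 0"
  shows "adapted (W2_mult x y) = adapted_mult (adapted x) (adapted (y :: 'a ^ 8))"
  unfolding vec_eq_iff forall_8 W2_mult_def W2_table_def W2_basis_components Let_def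
  by (simp add: adapted_def sum_8 char3_numerals[OF assms] algebra_simps)

section \<open>Linear maps and traces\<close>

text \<open>
  Linearity for modules over a ring in which \<open>0 = 1\<close> may hold.
\<close>

definition linear_map :: "('a::comm_unital_ring ^ 'n \<Rightarrow> 'a ^ 'm) \<Rightarrow> bool" where
  "linear_map f \<longleftrightarrow> (\<forall>x y. f (x + y) = f x + f y) \<and> (\<forall>r x. f (r *s x) = r *s f x)"

lemma linear_map_nth:
  fixes f :: "'a::comm_unital_ring ^ 'n \<Rightarrow> 'a ^ 'm"
  assumes "linear_map f"
  shows "f x $ i = (\<Sum>j\<in>UNIV. x $ j * f (axis j 1) $ i)"
proof -
  have add: "f (x + y) = f x + f y" and scale: "f (r *s x) = r *s f x" for x y r
    using assms by (simp_all add: linear_map_def)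
  have f0: "f 0 = 0"
    using add[of 0 0] by simp
  have "f (\<Sum>j\<in>A. g j) = (\<Sum>j\<in>A. f (g j))" if "finite A" for A :: "'n set" and g
    using that by (induction A rule: finite_induct) (simp_all add: f0 add)
  moreover have "x = (\<Sum>j\<in>UNIV. x $ j *s axis j 1)"
    by (simp add: vec_eq_iff axis_def if_distrib cong: if_cong)
  ultimately have "f x = (\<Sum>j\<in>UNIV. x $ j *s f (axis j 1))"
    by (metis (mono_tags, lifting) finite scale sum.cong)
  then show ?thesis
    by simp
qed

lemma linear_map_minus:
  fixes f :: "'a::comm_unital_ring ^ 'n \<Rightarrow> 'a ^ 'm"
  assumes "linear_map f"
  shows "f (x - y) = f x - f y"
  using assms unfolding linear_map_def by (metis add_diff_cancel_right' diff_add_cancel)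

lemma linear_map_uminus:
  fixes f :: "'a::comm_unital_ring ^ 'n \<Rightarrow> 'a ^ 'm"
  assumes "linear_map f"
  shows "f (- x) = - f x"
  using linear_map_minus[OF assms, of 0 x] linear_map_minus[OF assms, of 0 0] by simp

lemma linear_map_inv:
  fixes f :: "'a::comm_unital_ring ^ 'n \<Rightarrow> 'a ^ 'm"
  assumes "linear_map f" "bij f"
  shows "linear_map (inv f)"
proof -
  have f: "f (inv f y) = y" "inv f (f x) = x" for x y
    using assms(2) by (simp_all add: bij_is_surj surj_f_inv_f bij_is_inj)
  show ?thesis
    using assms(1) unfolding linear_map_def by (metis f)
qed

lemma trace_commute:
  fixes f :: "'a::comm_unital_ring ^ 'n \<Rightarrow> 'a ^ 'm" and g :: "'a ^ 'm \<Rightarrow> 'a ^ 'n"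
  assumes "linear_map f" "linear_map g"
  shows "(\<Sum>i\<in>UNIV. f (g (axis i 1)) $ i) = (\<Sum>i\<in>UNIV. g (f (axis i 1)) $ i)"
proof -
  have "(\<Sum>i\<in>UNIV. f (g (axis i 1)) $ i) =
      (\<Sum>i\<in>UNIV. \<Sum>j\<in>UNIV. g (axis i 1) $ j * f (axis j 1) $ i)"
    by (simp add: linear_map_nth[OF assms(1), of "g _"])
  also have "\<dots> = (\<Sum>j\<in>UNIV. \<Sum>i\<in>UNIV. f (axis j 1) $ i * g (axis i 1) $ j)"
    by (subst sum.swap) (simp add: mult.commute)
  also have "\<dots> = (\<Sum>j\<in>UNIV. g (f (axis j 1)) $ j)"
    by (simp add: linear_map_nth[OF assms(2), of "f _"])
  finally show ?thesis .
qed

section \<open>Invariants of an automorphism\<close>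

lemma linear_map_adapted_mult: "linear_map (adapted_mult x)"
  by (simp add: linear_map_def vec_eq_iff forall_8 algebra_simps)

text \<open>
  On the diagonal, \<open>x $ 1\<close> occurs with the coefficients \<open>-1, 1, -1, 1, 1, -1\<close> and \<open>x $ 8\<close> with the
  coefficients \<open>1, -1, 1, -1, -1\<close>.
\<close>

lemma trace_adapted_mult: "(\<Sum>i\<in>UNIV. adapted_mult x (axis i 1) $ i) = - x $ 8"
  by (simp add: sum_8 axis_def)

locale adapted_automorphism =
  fixes \<psi> :: "'a::comm_unital_ring ^ 8 \<Rightarrow> 'a ^ 8"
  assumes char3: "\<forall>r::'a. 3 * r = 0"
    and bij: "bij \<psi>"
    and linear: "linear_map \<psi>"
    and mult: "\<psi> (adapted_mult x y) = adapted_mult (\<psi> x) (\<psi> y)"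
begin

text \<open>
  As \<open>2 = -1\<close> is a unit, an element equal to its own negative vanishes. This is what makes the
  eigenvalues \<open>1\<close> and \<open>-1\<close> of left multiplication by \<open>f\<^sub>8\<close> distinguishable.
\<close>

lemma double: "r + r = - (r::'a)"
proof -
  have "r + r = 2 * r"
    by (simp only: numeral.simps distrib_right mult_1_left)
  then show ?thesis
    by (simp add: char3_numerals[OF char3])
qed

lemma zero_if_eq_uminus:
  assumes "(r::'a) = - r"
  shows "r = 0"
  using assms double[of r] by simp

text \<open>
  Left multiplication by \<open>\<psi> x\<close> is \<open>\<psi> \<circ> L \<circ> \<psi>\<^sup>-\<^sup>1\<close>, where \<open>L\<close> is left multiplication by \<open>x\<close>, so both have
  the same trace.
\<close>

lemma coordinate_8: "\<psi> x $ 8 = x $ 8"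
proof -
  have inv: "inv \<psi> (\<psi> y) = y" for y
    using bij by (simp add: bij_is_inj)
  have f: "\<psi> (inv \<psi> y) = y" for y
    using bij by (simp add: bij_is_surj surj_f_inv_f)
  have comp: "linear_map (\<lambda>y. adapted_mult x (inv \<psi> y))"
    using linear_map_inv[OF linear bij] linear_map_adapted_mult[of x]
    by (simp add: linear_map_def)
  have "(\<Sum>i\<in>UNIV. adapted_mult (\<psi> x) (axis i 1) $ i) =
      (\<Sum>i\<in>UNIV. \<psi> (adapted_mult x (inv \<psi> (axis i 1))) $ i)"
    by (simp add: mult f)
  also have "\<dots> = (\<Sum>i\<in>UNIV. adapted_mult x (axis i 1) $ i)"
    using trace_commute[OF linear comp] by (simp add: inv)
  finally show ?thesis
    by (simp add: trace_adapted_mult)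
qed

text \<open>
  The form is the last coordinate of the product of \<open>x\<close> and \<open>y\<close>. On the left, \<open>\<psi> y $ 8\<close> is already
  replaced by \<open>y $ 8\<close>.
\<close>

lemma form_invariant:
  "- (\<psi> x $ 1 * y $ 8) + \<psi> x $ 2 * \<psi> y $ 7 = - (x $ 1 * y $ 8) + x $ 2 * y $ 7"
  using coordinate_8[of "adapted_mult x y"] by (simp add: mult coordinate_8)

text \<open>
  Evaluating the form at \<open>\<psi> x\<close> and \<open>\<psi> y\<close> with \<open>y = f\<^sub>7\<close>, \<open>y = f\<^sub>8\<close> and \<open>x = f\<^sub>2\<close> gives coordinates 2, 1 and 7
  of an image respectively. The choice \<open>x = f\<^sub>2\<close>, \<open>y = f\<^sub>7\<close> makes \<open>a\<close> a unit, because the form is \<open>1\<close> there.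
\<close>

lemma coordinates_1_2_7:
  obtains a a' c where "a * a' = 1"
    "\<And>x. \<psi> x $ 1 = x $ 1 - c * a' * x $ 2" "\<And>x. \<psi> x $ 2 = a' * x $ 2"
    "\<And>x. \<psi> x $ 7 = a * x $ 7 - c * x $ 8"
proof -
  define a where "a = \<psi> (axis 7 1) $ 7"
  define a' where "a' = \<psi> (axis 2 1) $ 2"
  define c where "c = - \<psi> (axis 8 1) $ 7"
  have x2: "\<psi> x $ 2 * a = x $ 2" for x
    using form_invariant[of x "axis 7 1"] by (simp add: a_def axis_def)
  have inverse: "a' * a = 1"
    using x2[of "axis 2 1"] by (simp add: a'_def)
  have "\<psi> x $ 2 = (\<psi> x $ 2 * a) * a'" for x
    using inverse by (simp add: mult.assoc mult.commute[of a])
  then have \<psi>2: "\<psi> x $ 2 = a' * x $ 2" for x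
    by (metis x2 mult.commute)
  have \<psi>1: "\<psi> x $ 1 = x $ 1 - c * a' * x $ 2" for x
    using form_invariant[of x "axis 8 1"] by (simp add: c_def axis_def \<psi>2 algebra_simps)
  have "\<psi> x $ 7 = a * x $ 7 - c * x $ 8" for x
  proof -
    have cancel: "a * (a' * r) = r" for r
      using inverse by (metis mult.assoc mult.commute mult_1_left)
    have "a' * \<psi> x $ 7 = x $ 7 - a' * (c * x $ 8)"
      using form_invariant[of "axis 2 1" x] by (simp add: \<psi>1 \<psi>2 axis_def algebra_simps)
    then have "a * (a' * \<psi> x $ 7) = a * (x $ 7 - a' * (c * x $ 8))"
      by simp
    then show ?thesis
      by (simp add: right_diff_distrib cancel)
  qed
  with inverse \<psi>1 \<psi>2 show thesis
    by (intro that[of a a' c]) (simp_all add: mult.commute)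
qed

text \<open>
  The hypotheses describe the left annihilator of the algebra. It is preserved because \<open>\<psi>\<close> is surjective,
  and the third coordinate of \<open>\<psi> n\<close> times \<open>f\<^sub>1\<close> then yields the conclusion.
\<close>

lemma left_annihilator:
  assumes "n $ 1 = 0" "n $ 2 = 0" "n $ 8 = 0" "n $ 3 = n $ 7"
  shows "\<psi> n $ 3 = \<psi> n $ 7"
proof -
  obtain y where y: "\<psi> y = axis 1 1"
    using bij by (metis bij_pointE)
  have "adapted_mult n y = 0"
    using assms by (simp add: vec_eq_iff forall_8)
  then have "adapted_mult (\<psi> n) (axis 1 1) = 0"
    using mult[of n y] y linear_map_minus[OF linear, of 0 0] by simp
  then have "adapted_mult (\<psi> n) (axis 1 1) $ 3 = 0"
    by simp
  then show ?thesis
    by (simp add: axis_def)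
qed

text \<open>
  In adapted coordinates, the images of the basis no longer contain the differences such as \<open>b c - c\<close> of the
  final matrix. The scalar \<open>b\<close> is a unit because the element mapped to \<open>f\<^sub>6\<close> has vanishing
  coordinates 7 and 8, so that all contributions to coordinate 6 of its image are multiples of \<open>b\<close>.
\<close>

lemma images_of_adapted_basis:
  obtains a a' b c k where "a * a' = 1" "b dvd 1"
    "\<psi> (axis 1 1) = vector [1, 0, c, 0, 0, 0, 0, 0]"
    "\<psi> (axis 2 1) = vector [- c * a', a', c^2 * a', - (c^3) * a', 0, 0, 0, 0]"
    "\<psi> (axis 3 1) = vector [0, 0, a, 0, 0, 0, 0, 0]"
    "\<psi> (axis 4 1) = vector [0, 0, 0, a^2, 0, 0, 0, 0]"
    "\<psi> (axis 5 1) = vector [0, 0, 0, 0, b, b * c, 0, 0]"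
    "\<psi> (axis 6 1) = vector [0, 0, 0, 0, 0, a * b, 0, 0]"
    "\<psi> (axis 7 1) = vector [0, 0, 0, 0, 0, a * k, a, 0]"
    "\<psi> (axis 8 1) = vector [0, 0, 0, 0, - k, - (c * k), - c, 1]"
proof -
  obtain a a' c where unit: "a * a' = 1"
    and \<psi>1: "\<And>x. \<psi> x $ 1 = x $ 1 - c * a' * x $ 2"
    and \<psi>2: "\<And>x. \<psi> x $ 2 = a' * x $ 2"
    and \<psi>7: "\<And>x. \<psi> x $ 7 = a * x $ 7 - c * x $ 8"
    using coordinates_1_2_7 by blast
  have cancel: "a * (a' * r) = r" "a' * (a * r) = r" for r
    using unit by (metis mult.assoc mult.commute mult_1_left)+
  define f :: "8 \<Rightarrow> 'a ^ 8" where "f i = axis i 1" for i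
  have f_nth: "f i $ j = (if j = i then 1 else 0)" for i j
    by (simp add: f_def axis_def)
  note known = \<psi>1 \<psi>2 \<psi>7 coordinate_8 f_nth
  have E_mult: "adapted_mult (\<psi> (f i)) (\<psi> (f j)) $ l = \<psi> v $ l"
    if "adapted_mult (f i) (f j) = v" for i j l v
    using mult that by metis
  have E_mult_uminus: "adapted_mult (\<psi> (f i)) (\<psi> (f j)) $ l = - \<psi> v $ l"
    if "adapted_mult (f i) (f j) = - v" for i j l v
    using E_mult[OF that] by (simp add: linear_map_uminus[OF linear])
  note table = vec_eq_iff forall_8 f_nth

  have coordinate_3: "\<psi> (f 4) $ 3 = 0" "\<psi> (f 5) $ 3 = 0" "\<psi> (f 6) $ 3 = 0"
    using left_annihilator[of "f 4"] left_annihilator[of "f 5"] left_annihilator[of "f 6"]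
    by (simp_all add: known)
  have E3_plus_E7: "\<psi> (f 3) $ 3 + \<psi> (f 7) $ 3 = a"
  proof -
    have "\<psi> (f 3 + f 7) $ 3 = \<psi> (f 3 + f 7) $ 7"
      by (rule left_annihilator) (simp_all add: f_nth)
    moreover have "\<psi> (f 3 + f 7) = \<psi> (f 3) + \<psi> (f 7)"
      using linear by (simp add: linear_map_def)
    ultimately show ?thesis
      by (simp add: known)
  qed

  have "adapted_mult (f 8) (f 4) = f 4"
    by (simp add: table)
  note prod_84 = E_mult[OF this]
  \<comment> \<open>Coordinate 5 comes first: in coordinate 6 it occurs as a factor of the still unknown third coordinate
    of the image of \<open>f 8\<close>.\<close>
  have E4_5: "\<psi> (f 4) $ 5 = 0"
    using prod_84[of 5] by (simp add: known)
  have E4_6: "\<psi> (f 4) $ 6 = 0"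
    using prod_84[of 6] E4_5 by (intro zero_if_eq_uminus) (simp add: known)
  have "adapted_mult (f 2) (f 4) = f 3"
    by (simp add: table)
  note prod_24 = E_mult[OF this]
  have E3: "\<psi> (f 3) $ 3 = a' * \<psi> (f 4) $ 4"
      "\<psi> (f 3) $ 4 = 0" "\<psi> (f 3) $ 5 = 0" "\<psi> (f 3) $ 6 = 0"
    using prod_24[of 3] prod_24[of 4] prod_24[of 5] prod_24[of 6] coordinate_3 E4_5 E4_6
    by (simp_all add: known)
  have "adapted_mult (f 2) (f 3) = - f 1"
    by (simp add: table)
  note prod_23 = E_mult_uminus[OF this]
  \<comment> \<open>Coordinate 1 of \<open>\<psi> (f 1)\<close> is known to be \<open>1\<close>; this ties the scale of \<open>\<psi> (f 4)\<close> to \<open>a\<close>.\<close>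
  have "a' * (a' * \<psi> (f 4) $ 4) = 1"
    using prod_23[of 1] E3 by (simp add: known)
  then have "a * (a * (a' * (a' * \<psi> (f 4) $ 4))) = a * a"
    by simp
  then have E4_4: "\<psi> (f 4) $ 4 = a^2"
    by (simp add: cancel power2_eq_square)
  have E3_3: "\<psi> (f 3) $ 3 = a"
    using E3 by (simp add: E4_4 power2_eq_square cancel)
  have E1_3: "\<psi> (f 1) $ 3 = c"
    using prod_23[of 3] E3(2-) E3_3 by (simp add: known mult.assoc mult.commute[of a' a] unit)
  have E1: "\<psi> (f 1) $ 4 = 0" "\<psi> (f 1) $ 5 = 0" "\<psi> (f 1) $ 6 = 0"
    using prod_23[of 4] prod_23[of 5] prod_23[of 6] E3 by (simp_all add: known)

  define b where "b = a' * \<psi> (f 6) $ 6"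
  have E6_6: "\<psi> (f 6) $ 6 = a * b"
    by (simp add: b_def cancel)
  have "adapted_mult (f 8) (f 6) = - f 6"
    by (simp add: table)
  note prod_86 = E_mult_uminus[OF this]
  have E6_4: "\<psi> (f 6) $ 4 = 0"
    using prod_86[of 4] by (intro zero_if_eq_uminus) (simp add: known)
  have E6_5: "\<psi> (f 6) $ 5 = 0"
    using prod_86[of 5] by (simp add: known)
  have "adapted_mult (f 2) (f 6) = - f 5"
    by (simp add: table)
  note prod_26 = E_mult_uminus[OF this]
  have "c * b = \<psi> (f 5) $ 6"
    using prod_26[of 6] coordinate_3 E6_5 by (simp add: known E6_6 cancel mult.assoc)
  then have E5: "\<psi> (f 5) $ 4 = 0" "\<psi> (f 5) $ 5 = b" "\<psi> (f 5) $ 6 = b * c"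
    using prod_26[of 4] prod_26[of 5] E6_4 E6_5 by (simp_all add: known E6_6 cancel mult.commute)

  define k where "k = a' * \<psi> (f 7) $ 6"
  have E7_6: "\<psi> (f 7) $ 6 = a * k"
    by (simp add: k_def cancel)
  have E7_3: "\<psi> (f 7) $ 3 = 0"
    using E3_plus_E7 E3_3 by simp
  have "adapted_mult (f 8) (f 7) = - f 7"
    by (simp add: table)
  note prod_87 = E_mult_uminus[OF this]
  have E7_4: "\<psi> (f 7) $ 4 = 0"
    using prod_87[of 4] by (intro zero_if_eq_uminus) (simp add: known)
  have E7_5: "\<psi> (f 7) $ 5 = 0"
    using prod_87[of 5] by (simp add: known)
  have "adapted_mult (f 2) (f 7) = f 8"
    by (simp add: table)
  note prod_27 = E_mult[OF this]
  have E8: "\<psi> (f 8) $ 3 = 0" "\<psi> (f 8) $ 4 = 0" "\<psi> (f 8) $ 5 = - k" "\<psi> (f 8) $ 6 = - (c * k)"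
    using prod_27[of 3] prod_27[of 4] prod_27[of 5] prod_27[of 6] E7_3 E7_4 E7_5
    by (simp_all add: known E7_6 cancel mult.assoc)

  have "adapted_mult (f 8) (f 2) = f 2"
    by (simp add: table)
  note prod_82 = E_mult[OF this]
  have "- (c^2 * a') = \<psi> (f 2) $ 3 + \<psi> (f 2) $ 3"
    using prod_82[of 3] E8 by (simp add: known power2_eq_square algebra_simps)
  then have E2_3: "\<psi> (f 2) $ 3 = c^2 * a'"
    by (simp add: double)
  have E2_5: "\<psi> (f 2) $ 5 = 0"
    using prod_82[of 5] E8 by (simp add: known)
  have E2_6: "\<psi> (f 2) $ 6 = 0"
    using prod_82[of 6] E8 E2_5 by (intro zero_if_eq_uminus) (simp add: known)
  have "adapted_mult (f 2) (f 2) = 0"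
    by (simp add: table)
  then have "adapted_mult (\<psi> (f 2)) (\<psi> (f 2)) $ 3 = 0"
    using E_mult[of 2 2 0 3] linear_map_minus[OF linear, of 0 0]
    by simp
  then have "a' * \<psi> (f 2) $ 4 = c * a' * (c^2 * a') + c * a' * (c^2 * a')"
    by (simp add: known E2_3 algebra_simps)
  then have "a * (a' * \<psi> (f 2) $ 4) = a * - (c * a' * (c^2 * a'))"
    by (simp only: double)
  then have E2_4: "\<psi> (f 2) $ 4 = - (c^3) * a'"
    by (simp add: cancel power2_eq_square power3_eq_cube mult.assoc mult.left_commute[of a c])

  have "b dvd 1"
  proof -
    obtain x where x: "\<psi> x = f 6"
      using bij by (metis bij_pointE)
    have x8: "x $ 8 = 0"
      using coordinate_8[of x] x by (simp add: f_nth)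
    have "a' * (a * x $ 7) = 0"
      using \<psi>7[of x] x x8 by (simp add: f_nth)
    then have x7: "x $ 7 = 0"
      by (simp add: cancel)
    have "\<psi> x $ 6 = (\<Sum>j\<in>UNIV. x $ j * \<psi> (f j) $ 6)"
      unfolding f_def by (rule linear_map_nth[OF linear])
    then have "1 = b * (c * x $ 5 + a * x $ 6)"
      unfolding x using E3 E1 E5
      by (simp add: sum_8 x7 x8 E4_6 E6_6 E2_6 f_nth algebra_simps)
    then show ?thesis
      by (rule dvdI)
  qed
  with unit show thesis
    by (intro that[of a a' b c k], unfold f_def[symmetric] vec_eq_iff forall_8)
      (simp_all add: known coordinate_3 E4_5 E4_6 E3(2-) E4_4 E3_3 E1_3 E1
        E6_6 E6_4 E6_5 E5 E7_6 E7_3 E7_4 E7_5 E8 E2_3 E2_5 E2_6 E2_4)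
qed

end

section \<open>Transfer to the original basis\<close>

text \<open>
  The coordinate change is an isomorphism from \<open>W(2)\<close> onto the algebra with product \<open>adapted_mult\<close>, by
  \<open>adapted_W2_mult\<close>, so conjugation by it turns automorphisms into automorphisms.
\<close>

lemma adapted_automorphism_conjugate:
  fixes \<theta> :: "'a::comm_unital_ring ^ 8 \<Rightarrow> 'a ^ 8"
  assumes char3: "\<forall>r::'a. 3 * r = 0" and "W2_automorphism \<theta>"
  shows "adapted_automorphism (adapted \<circ> \<theta> \<circ> unadapted)"
proof
  have bij: "bij \<theta>" and add: "\<theta> (x + y) = \<theta> x + \<theta> y" and scale: "\<theta> (r *s x) = r *s \<theta> x"
    and mult: "\<theta> (W2_mult x y) = W2_mult (\<theta> x) (\<theta> y)" for x y r
    using assms(2) by (simp_all add: W2_automorphism_def)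
  have lin: "linear_map (adapted :: 'a ^ 8 \<Rightarrow> _)" "linear_map (unadapted :: 'a ^ 8 \<Rightarrow> _)"
    by (simp_all add: linear_map_def adapted_def unadapted_def vec_eq_iff forall_8 algebra_simps)
  show "\<forall>r::'a. 3 * r = 0"
    by (rule char3)
  have "bij (adapted :: 'a ^ 8 \<Rightarrow> _)"
    by (rule o_bij[of unadapted]) (simp_all add: fun_eq_iff)
  moreover have "bij (unadapted :: 'a ^ 8 \<Rightarrow> _)"
    by (rule o_bij[of adapted]) (simp_all add: fun_eq_iff)
  ultimately show "bij (adapted \<circ> \<theta> \<circ> unadapted)"
    using bij by (simp add: bij_comp)
  show "linear_map (adapted \<circ> \<theta> \<circ> unadapted)"
    using lin by (simp add: linear_map_def add scale)
  fix x y :: "'a ^ 8"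
  have "unadapted (adapted_mult x y) = W2_mult (unadapted x) (unadapted y)"
    using adapted_W2_mult[OF char3, of "unadapted x" "unadapted y"]
    by (metis adapted_unadapted unadapted_adapted)
  then show "(adapted \<circ> \<theta> \<circ> unadapted) (adapted_mult x y) =
      adapted_mult ((adapted \<circ> \<theta> \<circ> unadapted) x) ((adapted \<circ> \<theta> \<circ> unadapted) y)"
    by (simp add: mult adapted_W2_mult[OF char3])
qed

lemma unit_inv_eq:
  assumes "a * a' = (1::'a::comm_unital_ring)"
  shows "unit_inv a = a'"
  unfolding unit_inv_def
proof (rule the_equality)
  fix u
  assume "a * u = 1"
  then show "u = a'"
    using assms by (metis mult.assoc mult.commute mult_1_left)
qed (rule assms)

theorem theorem34:
  fixes \<theta> :: "'a::comm_unital_ring ^ 8 \<Rightarrow> 'a ^ 8"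
  assumes "\<forall>r::'a. 3 * r = 0"
    and "W2_automorphism \<theta>"
  shows "\<exists>a b c k. a dvd 1 \<and> b dvd 1 \<and> row_matrix \<theta> = W2_aut_matrix a b c k"
proof -
  define \<psi> where "\<psi> = adapted \<circ> \<theta> \<circ> unadapted"
  interpret adapted_automorphism \<psi>
    unfolding \<psi>_def using assms by (rule adapted_automorphism_conjugate)
  obtain a a' b c k where unit: "a * a' = 1" "b dvd 1" and E:
    "\<psi> (axis 1 1) = vector [1, 0, c, 0, 0, 0, 0, 0]"
    "\<psi> (axis 2 1) = vector [- c * a', a', c^2 * a', - (c^3) * a', 0, 0, 0, 0]"
    "\<psi> (axis 3 1) = vector [0, 0, a, 0, 0, 0, 0, 0]"
    "\<psi> (axis 4 1) = vector [0, 0, 0, a^2, 0, 0, 0, 0]"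
    "\<psi> (axis 5 1) = vector [0, 0, 0, 0, b, b * c, 0, 0]"
    "\<psi> (axis 6 1) = vector [0, 0, 0, 0, 0, a * b, 0, 0]"
    "\<psi> (axis 7 1) = vector [0, 0, 0, 0, 0, a * k, a, 0]"
    "\<psi> (axis 8 1) = vector [0, 0, 0, 0, - k, - (c * k), - c, 1]"
    by (rule images_of_adapted_basis)
  \<comment> \<open>From \<open>e\<^sub>5 = (e\<^sub>1 + e\<^sub>5) - e\<^sub>1\<close> and \<open>e\<^sub>6 = (e\<^sub>3 + e\<^sub>6) - e\<^sub>3\<close>.\<close>
  have basis: "adapted (axis i 1) = (if i = 5 then axis 5 1 - axis 1 1
      else if i = 6 then axis 6 1 - axis 3 1 else axis i (1::'a))" for i
    using exhaust_8[of i] by (auto simp: adapted_def axis_def vec_eq_iff forall_8)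
  have "row_matrix \<theta> $ i = unadapted (\<psi> (adapted (axis i 1)))" for i
    by (simp add: row_matrix_def matrix_def transpose_def \<psi>_def vec_eq_iff)
  moreover have "W2_aut_matrix a b c k $ i = unadapted (\<psi> (adapted (axis i 1)))" for i
    using exhaust_8[of i]
    by (elim disjE; simp add: basis linear_map_minus[OF linear] E W2_aut_matrix_def unit_inv_eq[OF unit(1)]
        unadapted_def vec_eq_iff forall_8)
  ultimately have "row_matrix \<theta> = W2_aut_matrix a b c k"
    by (simp add: vec_eq_iff)
  with unit show ?thesis
    by (metis dvdI)
qed

end
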